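(* Let $n,m\ge 1$ and let $\mathcal{F}$ be the $2^{n+m}$-dimensional fermionic Fock space of $n+m$ fermionic modes with annihilation operators $a_1,\dots,a_n,c_1,\dots,c_m$. Let $\rho$ be a fermionic state (density operator) on $\mathcal{F}$ compliant with the fermionic superselection rule. Then $$\operatorname{Tr}_c(\rho)=\Big(\mathcal{Q}^{-1}\big\vert_a\circ\operatorname{Tr}^{\mathrm{Bos.}}_c\circ\mathcal{Q}\Big)(\rho),$$ where $\operatorname{Tr}_c$ is the fermionic partial trace over the $c$ modes, $\mathcal{Q}$ is the map from fermionic states to qubit states determined by the operator ordering $a_1,\dots,a_n,c_1,\dots,c_m$, $\operatorname{Tr}^{\mathrm{Bos.}}_c$ is the usual partial trace over the $c$ qubits, and $\mathcal{Q}^{-1}\vert_a$ is the inverse of the corresponding map for the $a$ modes alone.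
   Context: **Fermionic Fock space.** The operators $a_1,\dots,a_n,c_1,\dots,c_m$ satisfy the canonical anticommutation relations: writing $f_1,\dots,f_{n+m}$ for the list $a_1,\dots,a_n,c_1,\dots,c_m$, one has $f_pf_q+f_qf_p=0$ and $f_pf_q^\dagger+f_q^\dagger f_p=\delta_{pq}$. The space $\mathcal{F}$ is generated by the creation operators acting on a unit vacuum vector $|0\rangle$ (also written $|0\rangle_a\tilde\otimes|0\rangle_c$) annihilated by all $f_p$. For $k_a=(i_1,\dots,i_n)\in\{0,1\}^n$ and $k_c=(j_1,\dots,j_m)\in\{0,1\}^m$ define $$|k_ak_c\rangle=(a_1^\dagger)^{i_1}\cdots(a_n^\dagger)^{i_n}(c_1^\dagger)^{j_1}\cdots(c_m^\dagger)^{j_m}|0\rangle .$$ These vectors form an orthonormal basis of $\mathcal{F}$. Write $\langle l_cl_a|:=(|l_al_c\rangle)^\dagger$. Every operator on $\mathcal{F}$ is uniquely of the form $$\rho=\sum_{k_a,l_a\in\{0,1\}^n;\;k_c,l_c\in\{0,1\}^m}\rho_{k_a,l_a,k_c,l_c}\,|k_ak_c\rangle\langle l_cl_a| .$$ **Fock space of the $a$ modes.** Let $\mathcal{F}_a$ be the $2^n$-dimensional fermionic Fock space of the $a$ modes, with vacuum $|0\rangle_a$ and orthonormal basis $|k_a\rangle=(a_1^\dagger)^{i_1}\cdots(a_n^\dagger)^{i_n}|0\rangle_a$. It is embedded isometrically in $\mathcal{F}$ by $V:|k_a\rangle\mapsto(a_1^\dagger)^{i_1}\cdots(a_n^\dagger)^{i_n}|0\rangle$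 (that is, $c$ modes in their vacuum). For an operator $X$ on $\mathcal{F}$, the notation $\langle 0|_c\,X\,|0\rangle_c$ means the operator $V^\dagger XV$ on $\mathcal{F}_a$. **Superselection rule.** $\rho$ complies with the fermionic superselection rule if it has no coherences between even and odd total particle number, i.e. $\rho$ commutes with the parity operator $(-1)^N$, where $N=\sum_i a_i^\dagger a_i+\sum_j c_j^\dagger c_j$. Equivalently, $\rho_{k_a,l_a,k_c,l_c}=0$ unless the total number of 1's in $(k_a,k_c)$ and in $(l_a,l_c)$ have the same parity. **Fermionic partial trace.** $$\operatorname{Tr}_c(\rho)=\sum_{j_1,\dots,j_m\in\{0,1\}}\langle 0|_c\,(c_m)^{j_m}\cdots(c_1)^{j_1}\,\rho\,(c_1^\dagger)^{j_1}\cdots(c_m^\dagger)^{j_m}\,|0\rangle_c ,$$ an operator on $\mathcal{F}_a$. **The map $\mathcal{Q}$.** $\mathcal{Q}(\rho)$ is obtained by writing $\rho$ in the basis $|k_ak_c\rangle$ (with the operator ordering fixed above) and formally replacing each fermionic $a_i$, $c_j$ by operators $a_i^{\mathrm{Bos.}}$, $c_j^{\mathrm{Bos.}}$ that commute between different modes, and the fermionic vacuum by their vacuum. Since occupation numbers are only 0 or 1, the target is the $(n+m)$-qubit space $(\mathbb{C}^2)^{\otimes n}\otimes(\mathbb{C}^2)^{\otimes m}$ with computational basis $|k_a\rangle_{\mathrm{Bos.}}\otimes|k_c\rangle_{\mathrm{Bos.}}$, and $\mathcal{Q}$ is the linear map on operators with $$\mathcal{Q}\big(|k_ak_c\rangle\langle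 l_cl_a|\big)=|k_a\rangle\langle l_a|_{\mathrm{Bos.}}\otimes|k_c\rangle\langle l_c|_{\mathrm{Bos.}} .$$ $\operatorname{Tr}^{\mathrm{Bos.}}_c$ is the usual partial trace over the second tensor factor $(\mathbb{C}^2)^{\otimes m}$. $\mathcal{Q}^{-1}\vert_a$ is the linear map from operators on $(\mathbb{C}^2)^{\otimes n}$ to operators on $\mathcal{F}_a$ given by $|k_a\rangle\langle l_a|_{\mathrm{Bos.}}\mapsto|k_a\rangle\langle l_a|$. *)

theory Defs
  imports "HOL-Analysis.Analysis"
begin

(* Finite-dimensional complex Hilbert spaces are complex ^ 'd; products of operators
   are written with **, since * acts entrywise on this type. *)
type_synonym 'd operator = "complex ^ 'd ^ 'd"

definition adj :: "complex ^ 'd ^ 'e \<Rightarrow> complex ^ 'e ^ 'd" where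
  "adj A = map_matrix cnj (transpose A)"

definition cinner :: "complex ^ 'd \<Rightarrow> complex ^ 'd \<Rightarrow> complex" where
  "cinner u v = (\<Sum>i\<in>UNIV. cnj (u $ i) * v $ i)"

definition ketbra :: "complex ^ 'e \<Rightarrow> complex ^ 'd \<Rightarrow> complex ^ 'd ^ 'e" where
  "ketbra u v = (\<chi> i j. u $ i * cnj (v $ j))"

definition cscale :: "complex \<Rightarrow> complex ^ 'd ^ 'e \<Rightarrow> complex ^ 'd ^ 'e" where
  "cscale z A = map_matrix ((*) z) A"

definition op_prod :: "'d::finite operator list \<Rightarrow> 'd operator" where
  "op_prod As = foldr (**) As (mat 1)"

definition density_operator :: "'d::finite operator \<Rightarrow> bool" where
  "density_operator \<rho> \<longleftrightarrow>
     adj \<rho> = \<rho> \<and> (\<forall>v. 0 \<le> Re (cinner v (\<rho> *v v))) \<and> trace \<rho> = 1"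


(* The family f of annihilation operators, indexed by the finite set 'k of modes, makes
   complex ^ 'd a Fock space with vacuum vac: canonical anticommutation relations, unit
   vacuum annihilated by every f p, and the whole space generated by creation operators
   acting on the vacuum.  The dimension 2 ^ CARD('k) is a consequence. *)
definition fock_space :: "('k::finite \<Rightarrow> 'd::finite operator) \<Rightarrow> complex ^ 'd \<Rightarrow> bool" where
  "fock_space f vac \<longleftrightarrow>
     (\<forall>p q. f p ** f q + f q ** f p = 0) \<and>
     (\<forall>p q. f p ** adj (f q) + adj (f q) ** f p = (if p = q then mat 1 else 0)) \<and>
     norm vac = 1 \<and>
     (\<forall>p. f p *v vac = 0) \<and>
     vec.span {op_prod (map (\<lambda>p. adj (f p)) ps) *v vac | ps. True} = UNIV"

definition number_op :: "('k::finite \<Rightarrow> 'd::finite operator) \<Rightarrow> 'd operator" where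
  "number_op f = (\<Sum>p\<in>UNIV. adj (f p) ** f p)"

(* (-1) ^ N by functional calculus; the description is unique when N is diagonalizable
   with eigenvalues in the natural numbers, as the number operator of a Fock space is. *)
definition minus_one_pow :: "'d::finite operator \<Rightarrow> 'd operator" where
  "minus_one_pow N =
     (THE P. \<forall>r v. N *v v = of_nat r *s v \<longrightarrow> P *v v = (-1) ^ r *s v)"

definition superselected :: "('k::finite \<Rightarrow> 'd::finite operator) \<Rightarrow> 'd operator \<Rightarrow> bool" where
  "superselected f \<rho> \<longleftrightarrow>
     \<rho> ** minus_one_pow (number_op f) = minus_one_pow (number_op f) ** \<rho>"


(* n ordered modes are a type 'n of class finite and linorder with CARD('n) = n;
   occupation numbers (i_1,...,i_n) in {0,1}^n are functions 'n => bool. *)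
definition modes :: "'n::{finite,linorder} list" where
  "modes = sorted_list_of_set UNIV"

(* (f_1^dagger)^{i_1} ... (f_n^dagger)^{i_n} *)
definition creation_string ::
    "('n::{finite,linorder} \<Rightarrow> 'd::finite operator) \<Rightarrow> ('n \<Rightarrow> bool) \<Rightarrow> 'd operator" where
  "creation_string f k = op_prod (map (\<lambda>i. if k i then adj (f i) else mat 1) modes)"

(* (f_n)^{i_n} ... (f_1)^{i_1} *)
definition annihilation_string ::
    "('n::{finite,linorder} \<Rightarrow> 'd::finite operator) \<Rightarrow> ('n \<Rightarrow> bool) \<Rightarrow> 'd operator" where
  "annihilation_string f k = op_prod (map (\<lambda>i. if k i then f i else mat 1) (rev modes))"

definition fock_ket ::
    "('n::{finite,linorder} \<Rightarrow> 'd::finite operator) \<Rightarrow> complex ^ 'd \<Rightarrow> ('n \<Rightarrow> bool) \<Rightarrow> complex ^ 'd" where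
  "fock_ket f vac k = creation_string f k *v vac"

definition fock_ket2 ::
    "('n::{finite,linorder} \<Rightarrow> 'd::finite operator) \<Rightarrow> ('m::{finite,linorder} \<Rightarrow> 'd operator) \<Rightarrow>
     complex ^ 'd \<Rightarrow> ('n \<Rightarrow> bool) \<Rightarrow> ('m \<Rightarrow> bool) \<Rightarrow> complex ^ 'd" where
  "fock_ket2 a c vac ka kc = (creation_string a ka ** creation_string c kc) *v vac"


(* The operators V, Q and the inverse of Q below are given by their values on kets or
   ketbras; in Fock spaces the kets form an orthonormal basis, so each exists uniquely.
   V maps the Fock space of the modes a' (a copy of the modes a) into that of the modes
   a and c, leaving the modes c in their vacuum. *)
definition vac_embedding ::
    "('n::{finite,linorder} \<Rightarrow> 'd::finite operator) \<Rightarrow> complex ^ 'd \<Rightarrow>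
     ('n \<Rightarrow> 'e::finite operator) \<Rightarrow> complex ^ 'e \<Rightarrow> complex ^ 'e ^ 'd" where
  "vac_embedding a vac a' vac' =
     (THE V. \<forall>k. V *v fock_ket a' vac' k = fock_ket a vac k)"

definition fermionic_ptrace ::
    "('n::{finite,linorder} \<Rightarrow> 'd::finite operator) \<Rightarrow> ('m::{finite,linorder} \<Rightarrow> 'd operator) \<Rightarrow>
     complex ^ 'd \<Rightarrow> ('n \<Rightarrow> 'e::finite operator) \<Rightarrow> complex ^ 'e \<Rightarrow>
     'd operator \<Rightarrow> 'e operator" where
  "fermionic_ptrace a c vac a' vac' \<rho> =
     (let V = vac_embedding a vac a' vac' in
      \<Sum>j\<in>UNIV. adj V ** (annihilation_string c j ** \<rho> ** creation_string c j) ** V)"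


(* The n-qubit space, the n-fold tensor power of C^2, is complex ^ ('n => bool), its
   computational basis being labelled by {0,1}^n; the tensor product of
   complex ^ 'i and complex ^ 'j is complex ^ ('i * 'j). *)
definition qubit_ket :: "('n::finite \<Rightarrow> bool) \<Rightarrow> complex ^ ('n \<Rightarrow> bool)" where
  "qubit_ket k = axis k 1"

definition tensor_op :: "'i::finite operator \<Rightarrow> 'j::finite operator \<Rightarrow> ('i \<times> 'j) operator" where
  "tensor_op A B = (\<chi> p q. A $ fst p $ fst q * B $ snd p $ snd q)"

definition bosonic_ptrace :: "('i::finite \<times> 'j::finite) operator \<Rightarrow> 'i::finite operator" where
  "bosonic_ptrace X = (\<chi> i i'. \<Sum>j\<in>UNIV. X $ (i, j) $ (i', j))"

definition qubit_map ::
    "('n::{finite,linorder} \<Rightarrow> 'd::finite operator) \<Rightarrow> ('m::{finite,linorder} \<Rightarrow> 'd operator) \<Rightarrow>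
     complex ^ 'd \<Rightarrow> 'd operator \<Rightarrow> (('n \<Rightarrow> bool) \<times> ('m \<Rightarrow> bool)) operator" where
  "qubit_map a c vac =
     (THE Q. Vector_Spaces.linear cscale cscale Q \<and>
        (\<forall>ka la kc lc.
           Q (ketbra (fock_ket2 a c vac ka kc) (fock_ket2 a c vac la lc)) =
           tensor_op (ketbra (qubit_ket ka) (qubit_ket la))
                     (ketbra (qubit_ket kc) (qubit_ket lc))))"

definition qubit_map_inv ::
    "('n::{finite,linorder} \<Rightarrow> 'e::finite operator) \<Rightarrow> complex ^ 'e \<Rightarrow>
     ('n \<Rightarrow> bool) operator \<Rightarrow> 'e operator" where
  "qubit_map_inv a' vac' =
     (THE R. Vector_Spaces.linear cscale cscale R \<and>
        (\<forall>k l. R (ketbra (qubit_ket k) (qubit_ket l)) =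
               ketbra (fock_ket a' vac' k) (fock_ket a' vac' l)))"

end

(* The vectors |k_a k_c> form an orthonormal basis, and so do the vectors |k_a>, so it suffices
   to compare matrix elements.  Moving the string of c's past the string of a's gives
   (c_1^dagger)^{j_1}...(c_m^dagger)^{j_m} V |k_a> = (-1)^(|j| |k_a|) |k_a j>, hence the
   (k_a, l_a) element of the fermionic partial trace is the sum over j of the elements
   rho_{k_a, l_a, j, j} of rho, weighted by (-1)^(|j| (|k_a| + |l_a|)); without this sign it is
   the element of the qubit partial trace.  By the superselection rule rho_{k_a, l_a, j, j}
   vanishes unless |k_a| + |l_a| is even, in which case the sign is 1. *)

theory Submission
  imports Defs
begin

section \<open>Operators and orthonormal bases\<close>

lemma adj_nth: "adj A $ i $ j = cnj (A $ j $ i)"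
  by (simp add: adj_def transpose_def map_matrix_def)

lemma cscale_nth: "cscale z A $ i $ j = z * A $ i $ j"
  by (simp add: cscale_def map_matrix_def)

lemma ketbra_nth: "ketbra u v $ i $ j = u $ i * cnj (v $ j)"
  by (simp add: ketbra_def)

lemma adj_adj: "adj (adj A) = A"
  by (simp add: vec_eq_iff adj_nth)

lemma adj_mult: "adj (A ** B) = adj B ** adj A"
  by (simp add: vec_eq_iff adj_nth matrix_matrix_mult_def mult.commute)

lemma adj_mat_1: "adj (mat 1) = mat 1"
  by (simp add: vec_eq_iff adj_nth mat_def)

lemma cinner_add_right: "cinner u (v + w) = cinner u v + cinner u w"
  by (simp add: cinner_def algebra_simps sum.distrib)

lemma cinner_scale_right: "cinner u (z *s v) = z * cinner u v"
  by (simp add: cinner_def sum_distrib_left algebra_simps)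

lemma cinner_scale_left: "cinner (z *s u) v = cnj z * cinner u v"
  by (simp add: cinner_def sum_distrib_left algebra_simps)

lemma cinner_zero_right: "cinner u 0 = 0"
  by (simp add: cinner_def)

lemma cinner_sum_right: "cinner u (sum g I) = (\<Sum>i\<in>I. cinner u (g i))"
  by (induction I rule: infinite_finite_induct) (simp_all add: cinner_zero_right cinner_add_right)

lemma cinner_self: "cinner v v = of_real ((norm v)\<^sup>2)"
  by (simp add: cinner_def norm_vec_def L2_set_def sum_nonneg complex_norm_square mult.commute
      del: of_real_power)

lemma cinner_adj: "cinner u (A *v v) = cinner (adj A *v u) v"
proof -
  have "cinner u (A *v v) = (\<Sum>i\<in>UNIV. \<Sum>j\<in>UNIV. cnj (u $ i) * (A $ i $ j * v $ j))"
    by (simp add: cinner_def matrix_vector_mult_def sum_distrib_left)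
  also have "\<dots> = (\<Sum>j\<in>UNIV. \<Sum>i\<in>UNIV. cnj (u $ i) * (A $ i $ j * v $ j))"
    by (rule sum.swap)
  also have "\<dots> = cinner (adj A *v u) v"
    by (simp add: cinner_def matrix_vector_mult_def adj_nth sum_distrib_left algebra_simps)
  finally show ?thesis .
qed

lemma matrix_vector_scale: "(A :: complex ^ 'd ^ 'e) *v (z *s v) = z *s (A *v v)"
  by (simp add: vec_eq_iff matrix_vector_mult_def sum_distrib_left algebra_simps)

lemma matrix_vector_uminus: "(A :: complex ^ 'd ^ 'e) *v (- v) = - (A *v v)"
  by (simp add: vec_eq_iff matrix_vector_mult_def sum_negf)

lemma matrix_sum_vector: "(sum g I :: complex ^ 'd ^ 'e) *v v = (\<Sum>i\<in>I. g i *v v)"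
  by (induction I rule: infinite_finite_induct) (simp_all add: matrix_vector_mult_add_rdistrib)

lemma cscale_vector: "cscale z A *v v = z *s (A *v v)"
  by (simp add: vec_eq_iff matrix_vector_mult_def cscale_nth sum_distrib_left algebra_simps)

lemma ketbra_vector: "ketbra u v *v w = cinner v w *s u"
  by (simp add: vec_eq_iff matrix_vector_mult_def ketbra_nth cinner_def sum_distrib_left
      algebra_simps)

lemma vector_space_cscale: "vector_space (cscale :: complex \<Rightarrow> complex ^ 'd ^ 'e \<Rightarrow> _)"
  by unfold_locales (simp_all add: vec_eq_iff cscale_nth algebra_simps)

section \<open>Orthonormal bases and comparison by matrix elements\<close>

definition orthonormal_basis :: "('i::finite \<Rightarrow> complex ^ 'd) \<Rightarrow> bool" where
  "orthonormal_basis e \<longleftrightarrow>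
     (\<forall>i j. cinner (e i) (e j) = (if i = j then 1 else 0)) \<and> vec.span (range e) = UNIV"

lemma orthonormal_basis_cinner:
  "orthonormal_basis e \<Longrightarrow> cinner (e i) (e j) = (if i = j then 1 else 0)"
  by (simp add: orthonormal_basis_def)

lemma matrix_eq_on_basis:
  fixes A B :: "complex ^ 'd::finite ^ 'e::finite"
  assumes "orthonormal_basis e" and eq: "\<And>i. A *v e i = B *v e i"
  shows "A = B"
proof -
  have "A *v v = B *v v" for v
  proof -
    have "v \<in> vec.span (range e)"
      using assms(1) by (simp add: orthonormal_basis_def)
    then show ?thesis
      by (induction rule: vec.span_induct_alt)
        (auto simp: matrix_vector_right_distrib matrix_vector_scale eq)
  qed
  then show ?thesis
    by (simp add: matrix_eq)
qed

lemma orthonormal_basis_expansion: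
  fixes v :: "complex ^ 'd::finite"
  assumes "orthonormal_basis e"
  shows "(\<Sum>i\<in>UNIV. cinner (e i) v *s e i) = v"
proof -
  \<comment> \<open>Resolution of the identity: by orthonormality the sum of projectors fixes every
    \<open>e j\<close>.\<close>
  have "(\<Sum>i\<in>UNIV. ketbra (e i) (e i)) = mat 1"
    by (rule matrix_eq_on_basis[OF assms])
      (simp add: matrix_sum_vector ketbra_vector orthonormal_basis_cinner[OF assms]
        if_distrib[where f="\<lambda>z. z *s _"] cong: if_cong)
  then have "(\<Sum>i\<in>UNIV. ketbra (e i) (e i)) *v v = v"
    by simp
  then show ?thesis
    by (simp add: matrix_sum_vector ketbra_vector)
qed

lemma vector_eq_on_basis:
  fixes v w :: "complex ^ 'd::finite"
  assumes "orthonormal_basis e" and "\<And>i. cinner (e i) v = cinner (e i) w"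
  shows "v = w"
proof -
  have "v = (\<Sum>i\<in>UNIV. cinner (e i) v *s e i)"
    by (rule orthonormal_basis_expansion[OF assms(1), symmetric])
  also have "\<dots> = w"
    unfolding assms(2) by (rule orthonormal_basis_expansion[OF assms(1)])
  finally show ?thesis .
qed

lemma operator_eq_on_basis:
  fixes A B :: "'d::finite operator"
  assumes "orthonormal_basis e" and "\<And>i j. cinner (e i) (A *v e j) = cinner (e i) (B *v e j)"
  shows "A = B"
  using matrix_eq_on_basis[OF assms(1)] vector_eq_on_basis[OF assms(1)] assms(2) by metis

lemma orthonormal_basis_qubit_ket: "orthonormal_basis (qubit_ket :: ('n::finite \<Rightarrow> bool) \<Rightarrow> _)"
proof -
  have "v = (\<Sum>k\<in>UNIV. v $ k *s qubit_ket k)" for v :: "complex ^ ('n \<Rightarrow> bool)"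
    by (simp add: qubit_ket_def basis_expansion)
  then have "v \<in> vec.span (range qubit_ket)" for v :: "complex ^ ('n \<Rightarrow> bool)"
    by (metis (no_types, lifting) rangeI vec.span_base vec.span_scale vec.span_sum)
  then show ?thesis
    by (auto simp: orthonormal_basis_def qubit_ket_def cinner_def axis_def
        if_distrib[where f="\<lambda>z. z * _"] if_distrib[where f=cnj] cong: if_cong)
qed

lemma cinner_qubit_ket: "cinner (qubit_ket k) (A *v qubit_ket l) = A $ k $ l"
  by (simp add: qubit_ket_def cinner_def axis_def matrix_vector_mult_def
        if_distrib[where f="\<lambda>z. z * _"] if_distrib[where f="\<lambda>z. _ * z"] if_distrib[where f=cnj]
        cong: if_cong)

text \<open>The nested conditionals have the shape that simplification produces when two
  orthonormality relations collapse a double sum.\<close>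

lemma sum_sum_delta:
  fixes g :: "'i::finite \<Rightarrow> 'j::finite \<Rightarrow> 'b::comm_monoid_add"
  shows "(\<Sum>i\<in>UNIV. \<Sum>j\<in>UNIV. if k = i then if j = l then g i j else 0 else 0) = g k l"
proof -
  have "(\<Sum>j\<in>UNIV. if k = i then if j = l then g i j else 0 else 0) = (if k = i then g i l else 0)" for i
    by simp
  then show ?thesis
    by simp
qed

lemma operator_expansion:
  fixes X :: "'d::finite operator"
  assumes "orthonormal_basis e"
  shows "X = (\<Sum>i\<in>UNIV. \<Sum>j\<in>UNIV. cscale (cinner (e i) (X *v e j)) (ketbra (e i) (e j)))"
  by (rule operator_eq_on_basis[OF assms])
    (simp add: sum_sum_delta matrix_sum_vector cscale_vector ketbra_vector cinner_sum_right cinner_scale_right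
      orthonormal_basis_cinner[OF assms] if_distrib[where f="\<lambda>z. _ * z"] cong: if_cong)

text \<open>The ketbras of an orthonormal basis act as matrix units: a linear map may be prescribed
  freely on them and is then determined. This resolves the descriptions in both
  \<open>qubit_map\<close> and \<open>qubit_map_inv\<close>.\<close>

lemma the_linear_on_ketbras:
  fixes e :: "'i::finite \<Rightarrow> complex ^ 'd::finite" and G :: "'i \<Rightarrow> 'i \<Rightarrow> 'f::finite operator"
  assumes "orthonormal_basis e"
  shows "(THE Q. Vector_Spaces.linear cscale cscale Q \<and>
                 (\<forall>i j. Q (ketbra (e i) (e j)) = G i j)) =
         (\<lambda>X. \<Sum>i\<in>UNIV. \<Sum>j\<in>UNIV. cscale (cinner (e i) (X *v e j)) (G i j))" (is "_ = ?Q")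
proof (rule the_equality)
  interpret C: vector_space "cscale :: complex \<Rightarrow> 'f operator \<Rightarrow> _"
    by (rule vector_space_cscale)
  have "Vector_Spaces.linear cscale cscale ?Q"
    by (auto simp: Vector_Spaces.linear_iff vector_space_cscale cinner_add_right cinner_scale_right
        matrix_vector_mult_add_rdistrib cscale_vector C.scale_left_distrib sum.distrib
        C.scale_sum_right)
  moreover have "?Q (ketbra (e k) (e l)) = G k l" for k l
    by (simp add: vec_eq_iff cscale_nth ketbra_vector cinner_scale_right
        orthonormal_basis_cinner[OF assms] sum_sum_delta eq_commute[of _ k] eq_commute[of l]
        if_distrib[where f="\<lambda>z. _ * z"] if_distrib[where f="\<lambda>z. z * _"] cong: if_cong)
  ultimately show "Vector_Spaces.linear cscale cscale ?Q \<and> (\<forall>i j. ?Q (ketbra (e i) (e j)) = G i j)"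
    by blast
next
  fix Q
  assume Q: "Vector_Spaces.linear cscale cscale Q \<and> (\<forall>i j. Q (ketbra (e i) (e j)) = G i j)"
  then interpret Q: Vector_Spaces.linear cscale cscale Q
    by blast
  show "Q = ?Q"
  proof
    fix X
    show "Q X = ?Q X"
      by (subst operator_expansion[OF assms, of X]) (simp add: Q.sum Q.scale Q)
  qed
qed


section \<open>Occupation number basis\<close>

text \<open>Recording only the modes that are filled, as a list, turns reordering of operators into
  rearrangement of lists, with concatenation for composition.\<close>

definition creation_word :: "('k \<Rightarrow> 'd::finite operator) \<Rightarrow> 'k list \<Rightarrow> complex ^ 'd \<Rightarrow> complex ^ 'd"
  where "creation_word f qs v = foldr (\<lambda>p w. adj (f p) *v w) qs v"

lemma creation_word_simps:
  "creation_word f [] v = v"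
  "creation_word f (p # qs) v = adj (f p) *v creation_word f qs v"
  "creation_word f (qs @ rs) v = creation_word f qs (creation_word f rs v)"
  by (simp_all add: creation_word_def)

lemma creation_word_zero: "creation_word f qs 0 = 0"
  by (induction qs) (simp_all add: creation_word_simps)

lemma creation_word_map: "creation_word f (map g qs) v = creation_word (f \<circ> g) qs v"
  by (induction qs) (simp_all add: creation_word_simps)

lemma op_prod_Cons: "op_prod (A # As) = A ** op_prod As"
  by (simp add: op_prod_def)

lemma op_prod_append: "op_prod (As @ Bs) = op_prod As ** op_prod Bs"
  by (induction As) (simp_all add: op_prod_def matrix_mul_assoc)

lemma op_prod_creation: "op_prod (map (\<lambda>p. adj (f p)) ps) *v v = creation_word f ps v"
  by (induction ps) (simp_all add: op_prod_def creation_word_simps flip: matrix_vector_mul_assoc)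

lemma creation_string_word: "creation_string f k *v v = creation_word f (filter k modes) v"
proof -
  have "op_prod (map (\<lambda>i. if k i then adj (f i) else mat 1) ps) *v v = creation_word f (filter k ps) v"
    for ps
    by (induction ps) (simp_all add: op_prod_def creation_word_simps flip: matrix_vector_mul_assoc)
  then show ?thesis
    by (simp add: creation_string_def)
qed

text \<open>Taking adjoints reverses products, which is exactly the reversed mode order of the
  annihilation string. Each summand of the partial trace is thereby a conjugation of the
  state.\<close>

lemma annihilation_string_adj: "annihilation_string f k = adj (creation_string f k)"
proof -
  have "op_prod (map (\<lambda>i. if k i then f i else mat 1) (rev ps)) =
        adj (op_prod (map (\<lambda>i. if k i then adj (f i) else mat 1) ps))" for ps
    by (induction ps) (simp_all add: op_prod_append op_prod_Cons adj_mult adj_adj adj_mat_1,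
        simp_all add: op_prod_def adj_mat_1)
  then show ?thesis
    by (simp add: annihilation_string_def creation_string_def)
qed

lemma modes_props: "distinct (modes :: 'n::{finite,linorder} list)"
  "set (modes :: 'n::{finite,linorder} list) = UNIV"
  by (simp_all add: modes_def)

section \<open>Consequences of the anticommutation relations\<close>

lemma fock_spaceD:
  assumes "fock_space f vac"
  shows "f p *v (adj (f q) *v v) = (if p = q then v else 0) - adj (f q) *v (f p *v v)"
    and "adj (f p) *v (adj (f q) *v v) = - (adj (f q) *v (adj (f p) *v v))"
    and "cinner vac vac = 1"
    and "f p *v vac = 0"
    and "vec.span (range (\<lambda>qs. creation_word f qs vac)) = UNIV"
proof -
  have "f p ** f q + f q ** f p = 0" for p q
    using assms by (simp add: fock_space_def)
  \<comment> \<open>Anticommutation of creation operators is the adjoint of that of annihilation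
    operators.\<close>
  then have "adj (f q ** f p + f p ** f q) = 0"
    by (simp add: vec_eq_iff adj_nth)
  then have "adj (f p) ** adj (f q) + adj (f q) ** adj (f p) = 0"
    by (simp add: vec_eq_iff adj_nth flip: adj_mult)
  then have "(adj (f p) ** adj (f q) + adj (f q) ** adj (f p)) *v v = 0"
    by simp
  then show "adj (f p) *v (adj (f q) *v v) = - (adj (f q) *v (adj (f p) *v v))"
    by (simp add: matrix_vector_mult_add_rdistrib eq_neg_iff_add_eq_0 matrix_vector_mul_assoc)
  have "f p ** adj (f q) + adj (f q) ** f p = (if p = q then mat 1 else 0)"
    using assms by (simp add: fock_space_def)
  then have "(f p ** adj (f q) + adj (f q) ** f p) *v v = (if p = q then v else 0)"
    by simp
  then show "f p *v (adj (f q) *v v) = (if p = q then v else 0) - adj (f q) *v (f p *v v)"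
    unfolding eq_diff_eq matrix_vector_mul_assoc matrix_vector_mult_add_rdistrib .
  show "cinner vac vac = 1" "f p *v vac = 0"
    using assms by (simp_all add: fock_space_def cinner_self)
  show "vec.span (range (\<lambda>qs. creation_word f qs vac)) = UNIV"
    using assms by (simp add: fock_space_def op_prod_creation full_SetCompr_eq)
qed

text \<open>The annihilator anticommutes past every factor, since none has its mode, and finally
  kills the vacuum.\<close>

lemma annihilator_creation_word:
  assumes "fock_space f vac" and "p \<notin> set qs"
  shows "f p *v creation_word f qs vac = 0"
  using assms(2)
  by (induction qs) (auto simp: creation_word_simps fock_spaceD(1,4)[OF assms(1)])

lemma occupation_creation_word:
  assumes "fock_space f vac" and "distinct qs"
  shows "adj (f p) *v (f p *v creation_word f qs vac) =
         (if p \<in> set qs then creation_word f qs vac else 0)"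
  using assms(2)
proof (induction qs)
  case Nil
  then show ?case
    by (simp add: creation_word_simps fock_spaceD(4)[OF assms(1)])
next
  case (Cons q qs)
  show ?case
  proof (cases "p = q")
    case True
    then show ?thesis
      using Cons annihilator_creation_word[OF assms(1), of q qs]
      by (simp add: creation_word_simps fock_spaceD(1)[OF assms(1)])
  next
    case False
    \<comment> \<open>Both \<open>f p\<close> and \<open>adj (f p)\<close> anticommute with
      \<open>adj (f q)\<close>, and the two signs cancel.\<close>
    have "adj (f p) *v (f p *v creation_word f (q # qs) vac) =
          adj (f q) *v (adj (f p) *v (f p *v creation_word f qs vac))"
      using False fock_spaceD(2)[OF assms(1), of p q]
      by (simp add: creation_word_simps fock_spaceD(1)[OF assms(1)] matrix_vector_uminus)
    with Cons False show ?thesis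
      by (simp add: creation_word_simps)
  qed
qed

lemma cinner_creation_word_self:
  assumes "fock_space f vac" and "distinct qs"
  shows "cinner (creation_word f qs vac) (creation_word f qs vac) = 1"
  using assms(2)
proof (induction qs)
  case Nil
  then show ?case
    by (simp add: creation_word_simps fock_spaceD(3)[OF assms(1)])
next
  case (Cons q qs)
  then show ?case
    \<comment> \<open>Moving the outer creation operator across the inner product yields
      \<open>f q\<close> next to \<open>adj (f q)\<close>; this pair acts as the identity on a word
      without \<open>q\<close>.\<close>
    using annihilator_creation_word[OF assms(1), of q qs]
    by (simp add: creation_word_simps cinner_adj adj_adj fock_spaceD(1)[OF assms(1)])
qed

lemma creation_operator_word:
  assumes "fock_space f vac"
  shows "adj (f p) *v creation_word f qs v =
         (-1) ^ length qs *s creation_word f qs (adj (f p) *v v)"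
proof (induction qs)
  case (Cons q qs)
  have "adj (f p) *v creation_word f (q # qs) v =
        - (adj (f q) *v (adj (f p) *v creation_word f qs v))"
    unfolding creation_word_simps by (rule fock_spaceD(2)[OF assms])
  also have "\<dots> = - ((-1) ^ length qs *s creation_word f (q # qs) (adj (f p) *v v))"
    unfolding Cons creation_word_simps matrix_vector_scale ..
  finally show ?case
    by simp
qed (simp add: creation_word_simps)

text \<open>Each factor of one word crosses each factor of the other, at the cost of one sign per
  crossing. This is the source of the sign in the partial trace.\<close>

lemma creation_word_swap:
  assumes "fock_space f vac"
  shows "creation_word f (ps @ qs) v = (-1) ^ (length ps * length qs) *s creation_word f (qs @ ps) v"
proof (induction ps arbitrary: v)
  case (Cons p ps)
  have "creation_word f ((p # ps) @ qs) v =
        (-1) ^ (length ps * length qs) *s (adj (f p) *v creation_word f (qs @ ps) v)"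
    using Cons[of v] by (simp add: creation_word_simps(2) matrix_vector_scale)
  also have "\<dots> = (-1) ^ (length (p # ps) * length qs) *s creation_word f (qs @ p # ps) v"
    by (simp add: creation_word_simps creation_operator_word[OF assms, of p qs] power_add)
  finally show ?case .
qed simp

text \<open>The operator ordering is carried by the list \<open>ps\<close> instead of an order on
  the type, so the same notion serves one family of modes and the joint modes of a sum type.\<close>

definition occupation_ket ::
    "('k \<Rightarrow> 'd::finite operator) \<Rightarrow> complex ^ 'd \<Rightarrow> 'k list \<Rightarrow> ('k \<Rightarrow> bool) \<Rightarrow> complex ^ 'd" where
  "occupation_ket f vac ps k = creation_word f (filter k ps) vac"

lemma creation_operator_occupation_ket:
  assumes "fock_space f vac" and "distinct ps" and "p \<in> set ps"
  shows "adj (f p) *v occupation_ket f vac ps k \<in> vec.span (range (occupation_ket f vac ps))"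
proof -
  obtain xs ys where ps: "ps = xs @ p # ys"
    using assms(3) by (meson split_list)
  \<comment> \<open>Pauli exclusion: by anticommutation with itself, this vector equals its own
    negative.\<close>
  have zero: "adj (f p) *v (adj (f p) *v v) = 0" for v
    using fock_spaceD(2)[OF assms(1), of p p v] by (simp add: vec_eq_iff)
  \<comment> \<open>The Jordan-Wigner sign, counting the occupied modes listed before
    \<open>p\<close>.\<close>
  define s :: complex where "s = (-1) ^ length (filter k xs)"
  define k' where "k' = k(p := True)"
  \<comment> \<open>Distinctness puts \<open>p\<close> in neither \<open>xs\<close> nor
    \<open>ys\<close>, so filling it changes neither sublist.\<close>
  have "filter k' xs = filter k xs" "filter k' ys = filter k ys"
    using assms(2) ps by (auto simp: k'_def intro!: filter_cong split: if_splits)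
  then have "adj (f p) *v occupation_ket f vac ps k =
      (if k p then 0 else s *s occupation_ket f vac ps k')"
    using zero[of "creation_word f (filter k ys) vac"]
    by (simp add: occupation_ket_def ps creation_word_simps creation_word_zero
        creation_operator_word[OF assms(1), of p "filter k xs"] s_def k'_def)
  then show ?thesis
    by (simp add: vec.span_zero vec.span_scale vec.span_base)
qed

lemma orthonormal_basis_occupation_ket:
  fixes f :: "'k::finite \<Rightarrow> 'd::finite operator"
  assumes "fock_space f vac" and "distinct ps" and "set ps = UNIV"
  shows "orthonormal_basis (occupation_ket f vac ps)"
proof -
  let ?e = "occupation_ket f vac ps"
  let ?S = "vec.span (range ?e)"
  have "cinner (?e k) (?e l) = (if k = l then 1 else 0)" for k l
  proof (cases "k = l")
    case True
    then show ?thesis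
      using assms(2) by (simp add: occupation_ket_def cinner_creation_word_self[OF assms(1)])
  next
    case False
    \<comment> \<open>The two kets are eigenvectors of the Hermitian operator \<open>adj (f p) ** f p\<close> with
      eigenvalues 0 and 1.\<close>
    then obtain p where p: "k p \<noteq> l p"
      by auto
    have n: "adj (f p) *v (f p *v ?e k) = (if k p then ?e k else 0)" for k
      using assms(2,3) by (simp add: occupation_ket_def occupation_creation_word[OF assms(1)])
    have "cinner (?e k) (adj (f p) *v (f p *v ?e l)) =
          cinner (adj (f p) *v (f p *v ?e k)) (?e l)"
      by (simp add: cinner_adj adj_adj)
    then show ?thesis
      using False p by (auto simp: n cinner_def split: if_splits)
  qed
  moreover have "?S = UNIV"
  proof -
    \<comment> \<open>The span of the kets is stable under creation operators. As it contains the
      vacuum, it contains every creation word, and these span the space.\<close>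
    have step: "adj (f p) *v v \<in> ?S" if "v \<in> ?S" for p v
      using that
    proof (induction rule: vec.span_induct_alt)
      case (step z x y)
      then show ?case
        using creation_operator_occupation_ket[OF assms(1,2), of p] assms(3)
        by (auto simp: matrix_vector_right_distrib matrix_vector_scale
            intro!: vec.span_add vec.span_scale)
    qed (simp add: vec.span_zero)
    have "creation_word f qs vac \<in> ?S" for qs
    proof (induction qs)
      case Nil
      have "vac = ?e (\<lambda>_. False)"
        by (simp add: occupation_ket_def creation_word_simps)
      then show ?case
        by (simp add: creation_word_simps) (metis rangeI vec.span_base)
    qed (simp add: creation_word_simps step)
    then have "vec.span (range (\<lambda>qs. creation_word f qs vac)) \<subseteq> ?S"
      by (intro vec.span_minimal) (auto simp: vec.subspace_span)
    then show ?thesis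
      by (simp add: fock_spaceD(5)[OF assms(1)] top.extremum_unique)
  qed
  ultimately show ?thesis
    by (simp add: orthonormal_basis_def)
qed


section \<open>Parity\<close>

lemma number_op_occupation_ket:
  fixes f :: "'k::finite \<Rightarrow> 'd::finite operator"
  assumes "fock_space f vac" and "distinct ps" and "set ps = UNIV"
  shows "number_op f *v occupation_ket f vac ps k =
         of_nat (card {p. k p}) *s occupation_ket f vac ps k"
proof -
  have "number_op f *v occupation_ket f vac ps k =
        (\<Sum>p\<in>UNIV. if k p then occupation_ket f vac ps k else 0)"
    using assms(2,3)
    by (simp add: number_op_def matrix_sum_vector occupation_ket_def
        occupation_creation_word[OF assms(1)] cong: if_cong flip: matrix_vector_mul_assoc)
  also have "\<dots> = of_nat (card {p. k p}) *s occupation_ket f vac ps k"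
    by (simp add: vec_eq_iff sum.If_cases of_nat_index)
  finally show ?thesis .
qed

text \<open>The description quantifies over all eigenvectors, not only those in the basis, so the
  diagonal candidate must be checked on each of them. Uniqueness needs only the values on the
  basis.\<close>

lemma minus_one_pow_diagonal:
  fixes N :: "'d::finite operator" and e :: "'i::finite \<Rightarrow> complex ^ 'd"
  assumes e: "orthonormal_basis e" and N: "adj N = N" "\<And>i. N *v e i = of_nat (r i) *s e i"
  shows "minus_one_pow N = (\<Sum>i\<in>UNIV. cscale ((-1) ^ r i) (ketbra (e i) (e i)))" (is "_ = ?P")
proof -
  have P: "cinner (e i) (?P *v v) = (-1) ^ r i * cinner (e i) v" for i v
    by (simp add: matrix_sum_vector cscale_vector ketbra_vector cinner_sum_right cinner_scale_right
        orthonormal_basis_cinner[OF e] if_distrib[where f="\<lambda>z. _ * z"] cong: if_cong)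
  have ex: "?P *v v = (-1) ^ s *s v" if v: "N *v v = of_nat s *s v" for s v
  proof (rule vector_eq_on_basis[OF e])
    fix i
    \<comment> \<open>Hermiticity lets \<open>N\<close> act on either side, so \<open>v\<close> has
      a component along \<open>e i\<close> only if \<open>r i = s\<close>.\<close>
    have "of_nat s * cinner (e i) v = cinner (N *v e i) v"
      using v N(1) by (metis cinner_adj cinner_scale_right)
    then have "of_nat s * cinner (e i) v = of_nat (r i) * cinner (e i) v"
      by (simp add: N(2) cinner_scale_left)
    then have "s = r i \<or> cinner (e i) v = 0"
      by auto
    then show "cinner (e i) (?P *v v) = cinner (e i) ((-1) ^ s *s v)"
      by (auto simp: P cinner_scale_right)
  qed
  show ?thesis
    unfolding minus_one_pow_def
  proof (rule the_equality)
    fix P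
    assume P': "\<forall>s v. N *v v = of_nat s *s v \<longrightarrow> P *v v = (-1) ^ s *s v"
    show "P = ?P"
      by (rule matrix_eq_on_basis[OF e]) (simp only: P'[rule_format, OF N(2)] ex[OF N(2)])
  qed (use ex in blast)
qed

text \<open>Evaluating both sides of the commutation with parity between the two kets multiplies the
  element by opposite signs, so it equals its own negative.\<close>

lemma superselected_matrix_element:
  fixes f :: "'k::finite \<Rightarrow> 'd::finite operator"
  assumes "fock_space f vac" and "distinct ps" and "set ps = UNIV" and "superselected f \<rho>"
    and odd: "odd (card {p. k p} + card {p. l p})"
  shows "cinner (occupation_ket f vac ps k) (\<rho> *v occupation_ket f vac ps l) = 0"
proof -
  let ?e = "occupation_ket f vac ps"
  let ?N = "\<lambda>k. card {p. k p}"
  let ?P = "minus_one_pow (number_op f)"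
  have e: "orthonormal_basis ?e"
    using assms(1-3) by (rule orthonormal_basis_occupation_ket)
  have adjN: "adj (number_op f) = number_op f"
  proof -
    have "adj (\<Sum>p\<in>I. adj (f p) ** f p) = (\<Sum>p\<in>I. adj (f p) ** f p)" for I
    proof (induction I rule: infinite_finite_induct)
      case (insert p I)
      have "adj (A + B) = adj A + adj B" for A B :: "'d operator"
        by (simp add: vec_eq_iff adj_nth)
      with insert show ?case
        by (simp add: adj_mult adj_adj)
    qed (simp_all add: vec_eq_iff adj_nth)
    then show ?thesis
      by (simp add: number_op_def)
  qed
  have P: "?P = (\<Sum>k\<in>UNIV. cscale ((-1) ^ ?N k) (ketbra (?e k) (?e k)))"
    using e adjN by (rule minus_one_pow_diagonal) (rule number_op_occupation_ket[OF assms(1-3)])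
  have left: "cinner (?e k) (?P *v v) = (-1) ^ ?N k * cinner (?e k) v" for k v
    by (simp add: P matrix_sum_vector cscale_vector ketbra_vector cinner_sum_right cinner_scale_right
        orthonormal_basis_cinner[OF e] if_distrib[where f="\<lambda>z. _ * z"] cong: if_cong)
  have right: "?P *v ?e l = (-1) ^ ?N l *s ?e l"
    by (rule vector_eq_on_basis[OF e])
      (simp add: left cinner_scale_right orthonormal_basis_cinner[OF e])
  have "\<rho> *v (?P *v ?e l) = ?P *v (\<rho> *v ?e l)"
    using assms(4) by (simp add: superselected_def matrix_vector_mul_assoc)
  then have "cinner (?e k) (\<rho> *v (?P *v ?e l)) = cinner (?e k) (?P *v (\<rho> *v ?e l))"
    by simp
  then have "(-1) ^ ?N l * cinner (?e k) (\<rho> *v ?e l) = (-1) ^ ?N k * cinner (?e k) (\<rho> *v ?e l)"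
    by (simp add: left right matrix_vector_scale cinner_scale_right)
  with odd show ?thesis
    by (cases "even (?N k)") auto
qed


section \<open>Two families of modes\<close>

lemma fock_ket_occupation_ket: "fock_ket f vac = occupation_ket f vac modes"
  by (simp add: fun_eq_iff fock_ket_def occupation_ket_def creation_string_word)

text \<open>All \<open>a\<close> modes precede all \<open>c\<close> modes: the ordering that
  determines \<open>qubit_map\<close>.\<close>

abbreviation sum_modes :: "('n::{finite,linorder} + 'm::{finite,linorder}) list" where
  "sum_modes \<equiv> map Inl modes @ map Inr modes"

lemma sum_modes_props:
  "distinct (sum_modes :: ('n::{finite,linorder} + 'm::{finite,linorder}) list)"
  "set (sum_modes :: ('n::{finite,linorder} + 'm::{finite,linorder}) list) = UNIV"
  by (auto simp: distinct_map modes_props UNIV_sum)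

lemma fock_ket2_word:
  "fock_ket2 a c vac k j =
   creation_word (case_sum a c) (map Inl (filter k modes) @ map Inr (filter j modes)) vac"
  by (simp add: fock_ket2_def creation_string_word creation_word_simps creation_word_map comp_def
      flip: matrix_vector_mul_assoc)

text \<open>Regards the two families as a single system, to which the basis and parity results
  apply.\<close>

lemma fock_ket2_occupation_ket:
  "fock_ket2 a c vac k j = occupation_ket (case_sum a c) vac sum_modes (case_sum k j)"
  by (simp add: fock_ket2_word occupation_ket_def filter_map comp_def)

lemma length_filter_modes: "length (filter k modes) = card {p. k p}"
  using distinct_card[of "filter k modes"] by (simp add: modes_props)

lemma card_case_sum:
  "card {p. case_sum k j p} = card {p. k p} + card {p. j p}"
  for k :: "'n::finite \<Rightarrow> bool" and j :: "'m::finite \<Rightarrow> bool"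
proof -
  have "{p. case_sum k j p} = {p. k p} <+> {p. j p}"
    by (auto simp: Plus_def split: sum.splits) (metis image_iff mem_Collect_eq obj_sumE)
  then show ?thesis
    by (simp add: card_Plus)
qed

text \<open>In the partial trace the \<open>c\<close> string stands to the left of the
  \<open>a\<close> string, opposite to \<open>fock_ket2\<close>; exchanging them gives the
  sign.\<close>

lemma creation_string_fock_ket:
  assumes "fock_space (case_sum a c) vac"
  shows "creation_string c j *v fock_ket a vac k =
         (-1) ^ (card {p. j p} * card {p. k p}) *s fock_ket2 a c vac k j"
proof -
  have "creation_string c j *v fock_ket a vac k =
        creation_word (case_sum a c) (map Inr (filter j modes) @ map Inl (filter k modes)) vac"
    by (simp add: fock_ket_def creation_string_word creation_word_simps creation_word_map comp_def)
  then show ?thesis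
    by (simp add: creation_word_swap[OF assms, of "map Inr _"] fock_ket2_word length_filter_modes)
qed

lemma orthonormal_basis_fock_ket2:
  fixes a :: "'n::{finite,linorder} \<Rightarrow> 'd::finite operator"
    and c :: "'m::{finite,linorder} \<Rightarrow> 'd operator"
  assumes "fock_space (case_sum a c) vac"
  shows "orthonormal_basis (\<lambda>(k, j). fock_ket2 a c vac k j)"
proof -
  let ?e = "occupation_ket (case_sum a c) vac sum_modes"
  let ?h = "\<lambda>(k :: 'n \<Rightarrow> bool, j :: 'm \<Rightarrow> bool). case_sum k j"
  have e: "orthonormal_basis ?e"
    using assms sum_modes_props by (rule orthonormal_basis_occupation_ket)
  \<comment> \<open>Joint occupation patterns correspond bijectively to pairs, by restriction to the
    two summands, so the joint basis is merely reindexed.\<close>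
  have "surj ?h"
    by (rule surjI[of _ "\<lambda>k. (k \<circ> Inl, k \<circ> Inr)"]) (auto simp: fun_eq_iff split: sum.splits)
  moreover have "inj ?h"
    by (rule inj_on_inverseI[of _ "\<lambda>k. (k \<circ> Inl, k \<circ> Inr)"]) auto
  moreover have "(\<lambda>(k, j). fock_ket2 a c vac k j) = ?e \<circ> ?h"
    by (auto simp: fock_ket2_occupation_ket)
  ultimately show ?thesis
    using e unfolding orthonormal_basis_def
    by (metis (no_types, lifting) comp_apply image_comp inj_eq)
qed

section \<open>The embedding and the qubit maps in coordinates\<close>

lemma vac_embedding_fock_ket:
  fixes a' :: "'n::{finite,linorder} \<Rightarrow> 'e::finite operator" and vac :: "complex ^ 'd::finite"
  assumes "fock_space a' vac'"
  shows "vac_embedding a vac a' vac' *v fock_ket a' vac' k = fock_ket a vac k"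
proof -
  let ?e = "fock_ket a' vac'"
  have e: "orthonormal_basis ?e"
    unfolding fock_ket_occupation_ket
    using assms modes_props by (rule orthonormal_basis_occupation_ket)
  \<comment> \<open>An explicit witness for the description; its prescribed values on a basis make
    it unique.\<close>
  let ?V = "\<Sum>k\<in>UNIV. ketbra (fock_ket a vac k) (?e k)"
  have V: "?V *v ?e k = fock_ket a vac k" for k
    by (simp add: matrix_sum_vector ketbra_vector orthonormal_basis_cinner[OF e]
        if_distrib[where f="\<lambda>z. z *s _"] cong: if_cong)
  have "vac_embedding a vac a' vac' = ?V"
    unfolding vac_embedding_def
    by (rule the_equality) (use V in \<open>auto intro!: matrix_eq_on_basis[OF e]\<close>)
  then show ?thesis
    by (simp add: V)
qed

lemma qubit_map_nth:
  fixes a :: "'n::{finite,linorder} \<Rightarrow> 'd::finite operator"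
    and c :: "'m::{finite,linorder} \<Rightarrow> 'd operator"
  assumes "fock_space (case_sum a c) vac"
  shows "qubit_map a c vac \<rho> $ (k, i) $ (l, j) =
         cinner (fock_ket2 a c vac k i) (\<rho> *v fock_ket2 a c vac l j)"
proof -
  let ?e = "\<lambda>(k, j). fock_ket2 a c vac k j"
  let ?G = "\<lambda>p q. tensor_op (ketbra (qubit_ket (fst p)) (qubit_ket (fst q)))
                            (ketbra (qubit_ket (snd p)) (qubit_ket (snd q)))"
  \<comment> \<open>Grouping the four occupation patterns into two pairs gives the form of
    \<open>the_linear_on_ketbras\<close>.\<close>
  have "qubit_map a c vac = (THE Q. Vector_Spaces.linear cscale cscale Q \<and>
                 (\<forall>p q. Q (ketbra (?e p) (?e q)) = ?G p q))"
    unfolding qubit_map_def by (rule arg_cong[where f=The]) (auto simp: fun_eq_iff)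
  then have Q: "qubit_map a c vac \<rho> =
      (\<Sum>p\<in>UNIV. \<Sum>q\<in>UNIV. cscale (cinner (?e p) (\<rho> *v ?e q)) (?G p q))"
    unfolding the_linear_on_ketbras[OF orthonormal_basis_fock_ket2[OF assms]] by (rule fun_cong)
  \<comment> \<open>A tensor product of matrix units is the matrix unit at the paired
    indices.\<close>
  have G: "?G p q $ r $ s = (if r = p then if q = s then 1 else 0 else 0)" for p q r s
    by (auto simp: tensor_op_def ketbra_nth qubit_ket_def axis_def prod_eq_iff)
  show ?thesis
    by (simp add: Q cscale_nth G sum_sum_delta if_distrib[where f="\<lambda>z. _ * z"] cong: if_cong)
qed

lemma qubit_map_inv_matrix_element:
  fixes a' :: "'n::{finite,linorder} \<Rightarrow> 'e::finite operator"
  assumes "fock_space a' vac'"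
  shows "cinner (fock_ket a' vac' k) (qubit_map_inv a' vac' X *v fock_ket a' vac' l) = X $ k $ l"
proof -
  let ?e = "fock_ket a' vac'"
  have e: "orthonormal_basis ?e"
    unfolding fock_ket_occupation_ket
    using assms modes_props by (rule orthonormal_basis_occupation_ket)
  show ?thesis
    unfolding qubit_map_inv_def the_linear_on_ketbras[OF orthonormal_basis_qubit_ket]
    by (simp add: cinner_qubit_ket matrix_sum_vector cscale_vector ketbra_vector cinner_sum_right
        cinner_scale_right orthonormal_basis_cinner[OF e] sum_sum_delta
        if_distrib[where f="\<lambda>z. _ * z"] cong: if_cong)
qed

lemma fermionic_ptrace_matrix_element:
  assumes "fock_space (case_sum a c) vac" and "fock_space a' vac'"
  shows "cinner (fock_ket a' vac' k) (fermionic_ptrace a c vac a' vac' \<rho> *v fock_ket a' vac' l) =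
    (\<Sum>j\<in>UNIV. (-1) ^ (card {p. j p} * (card {p. k p} + card {p. l p})) *
       cinner (fock_ket2 a c vac k j) (\<rho> *v fock_ket2 a c vac l j))"
proof -
  \<comment> \<open>The adjoint of the embedding and the annihilation string move to the bra, where
    they become the embedding and the creation string.\<close>
  have "cinner (fock_ket a' vac' k) (fermionic_ptrace a c vac a' vac' \<rho> *v fock_ket a' vac' l) =
    (\<Sum>j\<in>UNIV. cinner (creation_string c j *v fock_ket a vac k)
                      (\<rho> *v (creation_string c j *v fock_ket a vac l)))"
    by (simp add: fermionic_ptrace_def Let_def matrix_sum_vector cinner_sum_right cinner_adj adj_adj
        annihilation_string_adj vac_embedding_fock_ket[OF assms(2)] adj_mult
        flip: matrix_vector_mul_assoc)
  \<comment> \<open>Bra and ket each contribute a reordering sign; the signs are real, so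
    conjugation is harmless and the exponents add.\<close>
  then show ?thesis
    by (simp add: creation_string_fock_ket[OF assms(1)] matrix_vector_scale cinner_scale_left
        cinner_scale_right distrib_left power_add mult_ac)
qed

theorem theoremI1:
  fixes a :: "'n::{finite,linorder} \<Rightarrow> 'd::finite operator"
    and c :: "'m::{finite,linorder} \<Rightarrow> 'd operator"
    and vac :: "complex ^ 'd"
    and a' :: "'n \<Rightarrow> 'e::finite operator"
    and vac' :: "complex ^ 'e"
    and \<rho> :: "'d operator"
  assumes "fock_space (case_sum a c) vac"
    and "fock_space a' vac'"
    and "density_operator \<rho>"
    and "superselected (case_sum a c) \<rho>"
  shows "fermionic_ptrace a c vac a' vac' \<rho> =
    (qubit_map_inv a' vac' \<circ> bosonic_ptrace \<circ> qubit_map a c vac) \<rho>"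
proof (rule operator_eq_on_basis)
  show "orthonormal_basis (fock_ket a' vac')"
    unfolding fock_ket_occupation_ket
    using assms(2) modes_props by (rule orthonormal_basis_occupation_ket)
next
  fix k l
  let ?\<rho> = "\<lambda>j. cinner (fock_ket2 a c vac k j) (\<rho> *v fock_ket2 a c vac l j)"
  have sign: "(-1) ^ (card {p. j p} * (card {p. k p} + card {p. l p})) * ?\<rho> j = ?\<rho> j" for j
  proof (cases "even (card {p. k p} + card {p. l p})")
    case False
    then have "?\<rho> j = 0"
      \<comment> \<open>The particle numbers of \<open>j\<close> enter the total parity twice and
        cancel, so odd parity for \<open>k\<close> and \<open>l\<close> together is odd parity for
        the joint kets.\<close>
      unfolding fock_ket2_occupation_ket
      by (intro superselected_matrix_element[OF assms(1) sum_modes_props assms(4)])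
        (auto simp: card_case_sum)
    then show ?thesis
      by simp
  qed simp
  show "cinner (fock_ket a' vac' k) (fermionic_ptrace a c vac a' vac' \<rho> *v fock_ket a' vac' l) =
      cinner (fock_ket a' vac' k)
        ((qubit_map_inv a' vac' \<circ> bosonic_ptrace \<circ> qubit_map a c vac) \<rho> *v fock_ket a' vac' l)"
    unfolding fermionic_ptrace_matrix_element[OF assms(1,2)] sign comp_apply
      qubit_map_inv_matrix_element[OF assms(2)]
    by (simp add: bosonic_ptrace_def qubit_map_nth[OF assms(1)])
qed

end
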